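(* All Schubert matroids are Ehrhart positive: if $\mathsf{M}$ is a Schubert matroid, then all coefficients of the Ehrhart polynomial $\operatorname{ehr}(\mathscr{P}(\mathsf{M}),t)$ of its base polytope are nonnegative.
   Context: Lattice paths: for $0\le k\le n$, consider lattice paths from $(0,0)$ to $(n-k,k)$ with exactly $n$ steps, each equal to $+(1,0)$ (East, E) or $+(0,1)$ (North, N). For such a path $P$, let $s(P)\subseteq[n]$ be the set of positions of its north steps. A path $L$ lies below a path $U$ (equivalently $U$ lies above $L$) if $|s(L)\cap[m]|\le |s(U)\cap[m]|$ for every $m=1,\dots,n$. If $L$ lies below $U$, then $\{s(P): P \text{ lies above } L \text{ and below } U\}$ is the set of bases of a matroid $\mathsf{M}[L,U]$ of rank $k$ on $[n]$ (a lattice path matroid). Schubert matroid: write $\mathsf{M}[U]:=\mathsf{M}[L,U]$ where $L=\mathrm{E}\cdots\mathrm{E}\mathrm{N}\cdots\mathrm{N}$ ($n-k$ east steps followed by $k$ north steps). A matroid is a Schubert matroid if and only if it is isomorphic to a matroid of the form $\mathsf{M}[U]$. Base polytope: $\mathscr{P}(\mathsf{M})\subset\mathbb{R}^n$ is the convex hull of the indicator vectors of the bases of $\mathsf{M}$. The Ehrhart polynomial $\operatorname{ehr}(P,t)$ of a lattice polytope $P$ is the unique polynomial with $\operatorname{ehr}(P,m)=|mP\cap\mathbb{Z}^n|$ for all integers $m\ge0$. *)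

theory Defs
  imports "HOL-Analysis.Analysis" "HOL-Computational_Algebra.Polynomial"
begin

text \<open>A pair (ground set, bases); \<open>is_matroid\<close> singles out the matroids among these.\<close>

type_synonym 'a set_system = "'a set \<times> 'a set set"

definition ground :: "'a set_system \<Rightarrow> 'a set" where
  "ground M = fst M"

definition bases :: "'a set_system \<Rightarrow> 'a set set" where
  "bases M = snd M"

definition is_matroid :: "'a set_system \<Rightarrow> bool" where
  "is_matroid M \<longleftrightarrow>
     finite (ground M) \<and> bases M \<noteq> {} \<and> (\<forall>A\<in>bases M. A \<subseteq> ground M) \<and>
     (\<forall>A\<in>bases M. \<forall>B\<in>bases M. \<forall>a\<in>A - B. \<exists>b\<in>B - A. insert b (A - {a}) \<in> bases M)"

definition matroid_iso :: "'a set_system \<Rightarrow> 'b set_system \<Rightarrow> bool" where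
  "matroid_iso M N \<longleftrightarrow>
     (\<exists>\<phi>. bij_betw \<phi> (ground M) (ground N) \<and>
          (\<forall>A. A \<subseteq> ground M \<longrightarrow> (A \<in> bases M \<longleftrightarrow> \<phi> ` A \<in> bases N)))"

datatype step = East | North

definition lattice_paths :: "nat \<Rightarrow> nat \<Rightarrow> step list set" where
  "lattice_paths n k =
     {P. length P = n \<and> count_list P East = n - k \<and> count_list P North = k}"

text \<open>Steps are numbered from 1, whereas list indices start at 0.\<close>

definition north_steps :: "step list \<Rightarrow> nat set" where
  "north_steps P = {i \<in> {1..length P}. P ! (i - 1) = North}"

definition lies_below :: "step list \<Rightarrow> step list \<Rightarrow> bool" where
  "lies_below L U \<longleftrightarrow>
     (\<forall>m\<in>{1..length U}. card (north_steps L \<inter> {1..m}) \<le> card (north_steps U \<inter> {1..m}))"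

definition lattice_path_matroid ::
    "nat \<Rightarrow> nat \<Rightarrow> step list \<Rightarrow> step list \<Rightarrow> nat set_system" where
  "lattice_path_matroid n k L U =
     ({1..n}, {north_steps P | P. P \<in> lattice_paths n k \<and> lies_below L P \<and> lies_below P U})"

definition bottom_path :: "nat \<Rightarrow> nat \<Rightarrow> step list" where
  "bottom_path n k = replicate (n - k) East @ replicate k North"

definition schubert_matroid :: "'a set_system \<Rightarrow> bool" where
  "schubert_matroid M \<longleftrightarrow> is_matroid M \<and>
     (\<exists>n k U. k \<le> n \<and> U \<in> lattice_paths n k \<and>
        matroid_iso M (lattice_path_matroid n k (bottom_path n k) U))"

text \<open>The ground set may be any subset of the finite index type; the coordinates outside it vanish
  on the whole polytope. A ground set equal to the whole type gives the polytope in \<open>\<real>\<^sup>n\<close>, and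
  the empty ground set is covered too.\<close>

definition indicator_vec :: "'n::finite set \<Rightarrow> real ^ 'n" where
  "indicator_vec A = (\<chi> i. if i \<in> A then 1 else 0)"

definition base_polytope :: "'n::finite set_system \<Rightarrow> (real ^ 'n) set" where
  "base_polytope M = convex hull (indicator_vec ` bases M)"

definition lattice_points :: "(real ^ 'n::finite) set" where
  "lattice_points = {x. \<forall>i. x $ i \<in> \<int>}"

definition is_ehrhart_poly :: "(real ^ 'n::finite) set \<Rightarrow> real poly \<Rightarrow> bool" where
  "is_ehrhart_poly P p \<longleftrightarrow>
     (\<forall>m::nat. poly p (real m) = real (card ((\<lambda>x. real m *\<^sub>R x) ` P \<inter> lattice_points)))"

definition ehr :: "(real ^ 'n::finite) set \<Rightarrow> real poly" where
  "ehr P = (THE p. is_ehrhart_poly P p)"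

lemma is_ehrhart_poly_unique:
  assumes "is_ehrhart_poly P p" "is_ehrhart_poly P q"
  shows "p = q"
proof (rule ccontr)
  assume "p \<noteq> q"
  hence "finite {x. poly (p - q) x = 0}"
    by (intro poly_roots_finite) simp
  moreover have "range real \<subseteq> {x. poly (p - q) x = 0}"
    using assms by (auto simp: is_ehrhart_poly_def)
  ultimately have "finite (range real)"
    by (rule finite_subset[rotated])
  thus False
    by (simp add: finite_image_iff inj_on_def)
qed

lemma ehr_eqI: "is_ehrhart_poly P p \<Longrightarrow> ehr P = p"
  unfolding ehr_def by (blast intro: is_ehrhart_poly_unique)

lemma count_list_eq_card: "count_list P x = card {i \<in> {1..length P}. P ! (i - 1) = x}"
proof -
  have "{i \<in> {1..length P}. P ! (i - 1) = x} = Suc ` {j. j < length P \<and> P ! j = x}"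
  proof (intro equalityI subsetI)
    fix i assume "i \<in> {i \<in> {1..length P}. P ! (i - 1) = x}"
    thus "i \<in> Suc ` {j. j < length P \<and> P ! j = x}"
      by (intro image_eqI[of _ _ "i - 1"]) auto
  qed auto
  moreover have "{j. j < length P \<and> P ! j = x} = {j. j < length P \<and> x = P ! j}"
    by blast
  ultimately show ?thesis
    by (simp add: count_list_eq_length_filter length_filter_conv_card card_image)
qed

lemma north_steps_image:
  "north_steps ` lattice_paths n k = {A. A \<subseteq> {1..n} \<and> card A = k}"
proof (intro equalityI subsetI)
  fix A assume "A \<in> north_steps ` lattice_paths n k"
  thus "A \<in> {A. A \<subseteq> {1..n} \<and> card A = k}"
    by (auto simp: lattice_paths_def north_steps_def count_list_eq_card)
next
  fix A assume "A \<in> {A. A \<subseteq> {1..n} \<and> card A = k}"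
  hence A: "A \<subseteq> {1..n}" "card A = k" by auto
  define P where "P = map (\<lambda>i. if i \<in> A then North else East) [1..<Suc n]"
  have nth: "P ! (i - 1) = (if i \<in> A then North else East)" if "i \<in> {1..n}" for i
    using that unfolding P_def by (subst nth_map) (auto simp del: upt_Suc)
  have len: "length P = n" by (simp add: P_def)
  have N: "north_steps P = A"
    using A nth by (auto simp: north_steps_def len split: if_splits)
  have "{i \<in> {1..length P}. P ! (i - 1) = East} = {1..n} - A"
    using A nth by (auto simp: len split: if_splits)
  hence "count_list P East = n - k"
    using A by (simp add: count_list_eq_card card_Diff_subset finite_subset)
  moreover have "count_list P North = k"
    using A N by (simp add: count_list_eq_card north_steps_def)
  ultimately show "A \<in> north_steps ` lattice_paths n k"
    using N len by (auto simp: lattice_paths_def)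
qed

lemma bases_lattice_path_matroid:
  assumes "U \<in> lattice_paths n k"
  shows "bases (lattice_path_matroid n k L U) =
     {A. A \<subseteq> {1..n} \<and> card A = k \<and> (\<forall>m\<in>{1..n}. card (north_steps L \<inter> {1..m}) \<le> card (A \<inter> {1..m}) \<and>
        card (A \<inter> {1..m}) \<le> card (north_steps U \<inter> {1..m}))}" (is "_ = ?R")
proof -
  have "bases (lattice_path_matroid n k L U) =
      {A \<in> north_steps ` lattice_paths n k.
        \<forall>m\<in>{1..n}. card (north_steps L \<inter> {1..m}) \<le> card (A \<inter> {1..m}) \<and>
        card (A \<inter> {1..m}) \<le> card (north_steps U \<inter> {1..m})}"
    using assms by (auto simp: bases_def lattice_path_matroid_def lies_below_def lattice_paths_def)
  thus ?thesis
    by (auto simp: north_steps_image)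
qed

lemma card_Int_Suc:
  "card (A \<inter> {1..Suc m}) = card (A \<inter> {1..m}) + (if Suc m \<in> A then 1 else 0)"
proof -
  have "A \<inter> {1..Suc m} = (if Suc m \<in> A then insert (Suc m) (A \<inter> {1..m}) else A \<inter> {1..m})"
    by (auto simp: le_Suc_eq)
  thus ?thesis by auto
qed

lemma card_exchange_Int:
  fixes A :: "nat set" and m :: nat
  assumes "a \<in> A" "b \<notin> A" "1 \<le> a" "1 \<le> b"
  shows "int (card (insert b (A - {a}) \<inter> {1..m})) =
         int (card (A \<inter> {1..m})) + (if b \<le> m then 1 else 0) - (if a \<le> m then 1 else 0)"
proof (induction m)
  case 0
  show ?case using assms by simp
next
  case (Suc m)
  thus ?case using assms unfolding card_Int_Suc by (auto simp: le_Suc_eq)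
qed

theorem lattice_path_matroid_is_matroid:
  assumes L: "L \<in> lattice_paths n k" and U: "U \<in> lattice_paths n k" and LU: "lies_below L U"
  shows "is_matroid (lattice_path_matroid n k L U)"
proof -
  let ?M = "lattice_path_matroid n k L U"
  let ?c = "\<lambda>A m. card (A \<inter> {1..m::nat})"
  note bs = bases_lattice_path_matroid[OF U, of L]
  have ne: "bases ?M \<noteq> {}"
    using L LU by (auto simp: bases_def lattice_path_matroid_def lies_below_def)
  have ex: "\<exists>b\<in>B - A. insert b (A - {a}) \<in> bases ?M"
    if A: "A \<in> bases ?M" and B: "B \<in> bases ?M" and a: "a \<in> A - B" for A B a
  proof -
    have sub: "A \<subseteq> {1..n}" "B \<subseteq> {1..n}" and card: "card A = k" "card B = k"
      using A B by (auto simp: bs)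
    have fin: "finite A" "finite B"
      using sub by (meson finite_atLeastAtMost finite_subset)+
    have an: "1 \<le> a" "a \<le> n" using a sub by auto
    define f where "f m = int (?c A m) - int (?c B m)" for m
    have f0: "f 0 = 0" by (simp add: f_def)
    have fn: "f n = 0" using sub card by (simp add: f_def Int_absorb2)
    have fS: "f (Suc m) = f m + (if Suc m \<in> A then 1 else 0) - (if Suc m \<in> B then 1 else 0)" for m
      by (simp del: One_nat_def add: f_def card_Int_Suc)
    have fa: "f a = f (a - 1) + 1"
      using fS[of "a - 1"] a an by simp
    have key: "\<exists>b. b \<in> B - A \<and> b \<in> {1..n} \<and>
        ((a < b \<and> (\<forall>m. a \<le> m \<and> m < b \<longrightarrow> f m \<ge> 1)) \<or> (b < a \<and> (\<forall>m. b \<le> m \<and> m < a \<longrightarrow> f m \<le> -1)))"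
    proof (cases "f a \<ge> 1")
      case True
      define b where "b = (LEAST b. a < b \<and> f b \<le> 0)"
      have "a < n \<and> f n \<le> 0" using True fn an by (metis le_neq_implies_less not_one_le_zero order_refl)
      hence b: "a < b" "f b \<le> 0" "b \<le> n"
        unfolding b_def using LeastI[of "\<lambda>b. a < b \<and> f b \<le> 0" n]
          Least_le[of "\<lambda>b. a < b \<and> f b \<le> 0" n] by auto
      have m: "f m \<ge> 1" if "a \<le> m" "m < b" for m
        using not_less_Least[OF that(2)[unfolded b_def]] that True by (cases "m = a") auto
      obtain c where c: "b = Suc c" using b by (cases b) auto
      have "b \<in> B - A" using m[of c] fS[of c] b c by (auto split: if_splits)
      thus ?thesis using b m by auto
    next
      case False
      define d where "d = (GREATEST d. d < a \<and> f d \<ge> 0)"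
      have ex0: "0 < a \<and> f 0 \<ge> 0" using an f0 by simp
      have d: "d < a" "f d \<ge> 0"
        using GreatestI_nat[where P = "\<lambda>d. d < a \<and> f d \<ge> 0" and b = a, OF ex0]
        by (auto simp: d_def)
      have m: "f m \<le> -1" if "d < m" "m < a" for m
      proof (rule ccontr)
        assume "\<not> f m \<le> -1"
        hence "m \<le> d" unfolding d_def using that
          by (intro Greatest_le_nat[where b = a]) auto
        thus False using that by simp
      qed
      have "d \<noteq> a - 1" using False fa d by auto
      hence da: "Suc d < a" using d by auto
      have "Suc d \<in> B - A" using m[of "Suc d"] fS[of d] d da by (auto split: if_splits)
      thus ?thesis using m da an by (intro exI[of _ "Suc d"]) auto
    qed
    then obtain b where b: "b \<in> B - A" "b \<in> {1..n}"
      and cases: "(a < b \<and> (\<forall>m. a \<le> m \<and> m < b \<longrightarrow> f m \<ge> 1)) \<or>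
                  (b < a \<and> (\<forall>m. b \<le> m \<and> m < a \<longrightarrow> f m \<le> -1))"
      by blast
    let ?A = "insert b (A - {a})"
    have "card ?A = Suc (card (A - {a}))"
      using b fin by (intro card_insert_disjoint) auto
    also have "\<dots> = card A"
      using a fin by (intro card_Suc_Diff1) auto
    finally have "card ?A = k" using card by simp
    moreover have "?A \<subseteq> {1..n}" using b sub by auto
    moreover have "?c (north_steps L) m \<le> ?c ?A m \<and> ?c ?A m \<le> ?c (north_steps U) m"
      if "m \<in> {1..n}" for m
    proof -
      have cA: "int (?c ?A m) = int (?c A m) + (if b \<le> m then 1 else 0) - (if a \<le> m then 1 else 0)"
        using a b an by (intro card_exchange_Int) auto
      have "?c (north_steps L) m \<le> ?c A m" "?c A m \<le> ?c (north_steps U) m"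
           "?c (north_steps L) m \<le> ?c B m" "?c B m \<le> ?c (north_steps U) m"
        using A B that by (auto simp: bs)
      moreover have "f m = int (?c A m) - int (?c B m)" by (simp add: f_def)
      moreover have "a \<le> m \<and> m < b \<Longrightarrow> f m \<ge> 1" "b \<le> m \<and> m < a \<Longrightarrow> f m \<le> -1"
        using cases by auto
      ultimately show ?thesis using cA by (auto split: if_splits)
    qed
    ultimately have "?A \<in> bases ?M" unfolding bs by blast
    thus ?thesis using b by blast
  qed
  show ?thesis
    unfolding is_matroid_def
  proof (intro conjI ballI)
    show "finite (ground ?M)" by (simp add: ground_def lattice_path_matroid_def)
    show "A \<subseteq> ground ?M" if "A \<in> bases ?M" for A
      using that unfolding bs by (simp add: ground_def lattice_path_matroid_def)
  qed (fact ne, fact ex)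
qed

end

theory Submission
  imports Defs
begin

text \<open>Let \<open>U\<close> be the path of a Schubert matroid. A lattice point of the \<open>t\<close>-fold dilation of the
  base polytope is a sequence with entries in \<open>{0..t}\<close> whose partial sums stay below \<open>t\<close> times
  the height of \<open>U\<close> and meet that bound at the end
  (\<open>card_lattice_points_base_polytope\<close>). Such a sequence is recorded by its slacks, the distances of
  the partial sums from the bound. A positive slack is \<open>h * t + r + 1\<close> with \<open>r < t\<close>. Each step
  keeps the block \<open>h\<close> or changes it by one, and prescribes whether the residue \<open>r\<close> weakly
  increases or decreases. Fix the sequence of blocks. Then the residues between two consecutive
  visits to slack \<open>0\<close> are the order-preserving labellings of a fence poset by \<open>{0..<t}\<close>, and
  different excursions are independent. So the Ehrhart polynomial is a sum of products of order
  polynomials of fences (\<open>slack_count_positive\<close>), and it remains to see that these have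
  nonnegative coefficients (\<open>nonneg_fence_poly\<close>).

  An order polynomial \<open>P\<close> satisfies \<open>P(s + t) = \<Sum> P\<^sub>I(s) * P\<^sub>J(t)\<close>, summed over the splittings
  of the poset into a down-set \<open>I\<close> and its complement \<open>J\<close>. Taking the derivative at \<open>s = 0\<close>
  leaves only the connected \<open>I\<close>, because the order polynomial of a disconnected poset is a
  product of polynomials that vanish at \<open>0\<close> and so has no linear term. Thus the derivative of a fence polynomial is a sum of products of smaller fence
  polynomials and the linear coefficients of fences. For a fence with \<open>a\<close> ascending and \<open>b\<close>
  descending steps this coefficient is \<open>a! * b! / (a + b + 1)!\<close>, which is positive, and the claim
  follows by induction on the length.

  The derivative formula (\<open>pderiv_fence_poly\<close>) is verified here without the splitting: fence
  polynomials are determined by their values on chains and by the rule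
  \<open>P(u \<le> v) + P(u \<ge> v) = P(u) * P(v) + P(uv)\<close> for a single step (\<open>fence_poly_resolve\<close>), and both
  sides of the formula obey the derivative of this rule (\<open>resolve_fence_deriv\<close>) and agree on
  chains (\<open>pderiv_chain_poly\<close>).\<close>

section \<open>Polynomials with nonnegative coefficients\<close>

definition nonneg_poly :: "real poly \<Rightarrow> bool" where
  "nonneg_poly p \<longleftrightarrow> (\<forall>i. coeff p i \<ge> 0)"

lemma nonneg_poly_const: "c \<ge> 0 \<Longrightarrow> nonneg_poly [:c:]"
  by (auto simp: nonneg_poly_def coeff_pCons split: nat.splits)

lemma nonneg_poly_0: "nonneg_poly 0"
  by (simp add: nonneg_poly_def)

lemma nonneg_poly_add: "nonneg_poly p \<Longrightarrow> nonneg_poly q \<Longrightarrow> nonneg_poly (p + q)"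
  by (simp add: nonneg_poly_def)

lemma nonneg_poly_mult: "nonneg_poly p \<Longrightarrow> nonneg_poly q \<Longrightarrow> nonneg_poly (p * q)"
  by (auto simp: nonneg_poly_def coeff_mult intro!: sum_nonneg)

lemma nonneg_poly_integrate:
  assumes "nonneg_poly (pderiv p)" "coeff p 0 \<ge> 0"
  shows "nonneg_poly p"
  unfolding nonneg_poly_def
proof
  fix i show "coeff p i \<ge> 0"
  proof (cases i)
    case (Suc j)
    have "real (Suc j) * coeff p (Suc j) \<ge> 0"
      using assms(1) by (simp add: nonneg_poly_def coeff_pderiv)
    thus ?thesis using Suc by (simp only: zero_le_mult_iff) auto
  qed (use assms in simp)
qed

lemma poly_eqI_nat:
  fixes p q :: "real poly"
  assumes "\<And>t::nat. poly p (real t) = poly q (real t)"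
  shows "p = q"
proof (rule ccontr)
  assume "p \<noteq> q"
  hence "finite {x. poly (p - q) x = 0}"
    by (intro poly_roots_finite) simp
  moreover have "range real \<subseteq> {x. poly (p - q) x = 0}"
    using assms by auto
  ultimately have "finite (range real)"
    by (rule finite_subset[rotated])
  thus False
    by (simp add: finite_image_iff inj_on_def)
qed

section \<open>Order polynomials of fences\<close>

text \<open>A word over \<open>bool\<close> with \<open>n\<close> letters encodes a fence poset on \<open>n + 1\<close> elements:
  \<open>True\<close> stands for a step \<open>r \<le> r'\<close> and \<open>False\<close> for a step \<open>r \<ge> r'\<close> between
  neighbours. \<open>fence_from t w r\<close> is the number of labellings by \<open>{..<t}\<close> that satisfy
  these inequalities and begin with the label \<open>r\<close>, and \<open>fence_count t w\<close> is the number of all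
  labellings. Both are real numbers so that they may be subtracted.\<close>

fun fence_from :: "nat \<Rightarrow> bool list \<Rightarrow> nat \<Rightarrow> real" where
  "fence_from t [] r = 1"
| "fence_from t (True # w) r = (\<Sum>r'\<in>{r..<t}. fence_from t w r')"
| "fence_from t (False # w) r = (\<Sum>r'\<le>r. fence_from t w r')"

definition fence_count :: "nat \<Rightarrow> bool list \<Rightarrow> real" where
  "fence_count t w = (\<Sum>r<t. fence_from t w r)"

lemma fence_from_resolve:
  assumes "r < t"
  shows "fence_from t (u @ True # v) r + fence_from t (u @ False # v) r =
         fence_from t u r * fence_count t v + fence_from t (u @ v) r"
  using assms
proof (induction u arbitrary: r)
  case Nil
  have "{..<t} = {..<r} \<union> {r..<t}" "{..<r} \<inter> {r..<t} = {}" using Nil by auto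
  hence "fence_count t v = (\<Sum>r'<r. fence_from t v r') + (\<Sum>r'\<in>{r..<t}. fence_from t v r')"
    unfolding fence_count_def by (simp add: sum.union_disjoint)
  moreover have "(\<Sum>r'\<le>r. fence_from t v r') = (\<Sum>r'<r. fence_from t v r') + fence_from t v r"
    by (simp add: lessThan_Suc_atMost[symmetric])
  ultimately show ?case by simp
next
  case (Cons x u)
  thus ?case
    by (cases x) (simp_all add: sum.distrib[symmetric] sum_distrib_right)
qed

text \<open>Of two neighbouring labels one is at most the other, and both inequalities hold exactly when
  the labels are equal. Dropping the comparison splits the fence, and equality contracts it.\<close>

lemma fence_count_resolve:
  "fence_count t (u @ True # v) + fence_count t (u @ False # v) =
   fence_count t u * fence_count t v + fence_count t (u @ v)"
  unfolding fence_count_def sum.distrib[symmetric] sum_distrib_right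
  by (intro sum.cong refl) (simp add: fence_from_resolve fence_count_def)

lemma fence_from_replicate: "fence_from t (replicate n False) r = real ((r + n) choose n)"
proof (induction n arbitrary: r)
  case (Suc n)
  have "fence_from t (replicate (Suc n) False) r = real (\<Sum>r'\<le>r. (r' + n) choose n)"
    by (simp add: Suc)
  also have "(\<Sum>r'\<le>r. (r' + n) choose n) = Suc (n + r) choose Suc n"
    using choose_rising_sum(1)[of n r] by (simp add: add.commute)
  finally show ?case by (simp add: add.commute)
qed simp

lemma fence_count_replicate: "fence_count t (replicate n False) = real ((t + n) choose Suc n)"
proof (induction t)
  case (Suc t)
  thus ?case by (simp add: fence_count_def fence_from_replicate)
qed (simp add: fence_count_def)

lemma fence_count_replicate_Suc:
  "real (Suc (Suc n)) * fence_count t (replicate (Suc n) False) =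
   fence_count t (replicate n False) * (real t + real (Suc n))"
proof -
  have "Suc (Suc n) * ((t + Suc n) choose Suc (Suc n)) = (t + Suc n) * ((t + n) choose Suc n)"
    using Suc_times_binomial[of "Suc n" "t + n"] by simp
  hence "real (Suc (Suc n)) * real ((t + Suc n) choose Suc (Suc n)) =
         (real t + real (Suc n)) * real ((t + n) choose Suc n)"
    by (metis of_nat_add of_nat_mult)
  thus ?thesis unfolding fence_count_replicate by (simp add: mult.commute)
qed

text \<open>Induction for words: the letters \<open>True\<close> are removed one after the other by
  \<open>fence_count_resolve\<close>, down to the chains \<open>replicate n False\<close>.\<close>

lemma resolve_induct [case_names chain resolve]:
  assumes chain: "\<And>n. Q (replicate n False)"
    and resolve: "\<And>u v. Q u \<Longrightarrow> Q v \<Longrightarrow> Q (u @ v) \<Longrightarrow> Q (u @ False # v) \<Longrightarrow> Q (u @ True # v)"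
  shows "Q w"
proof (induction w rule: measure_induct_rule[where f = "\<lambda>w. length w + count_list w True"])
  case (less w)
  show ?case
  proof (cases "True \<in> set w")
    case True
    then obtain u v where w: "w = u @ True # v" by (auto dest: split_list)
    show ?thesis unfolding w by (intro resolve less) (simp_all add: w)
  next
    case False
    hence "w = replicate (length w) False"
      by (metis (full_types) replicate_eqI)
    thus ?thesis using chain by metis
  qed
qed

lemma fence_poly_exists: "\<exists>p. \<forall>t. poly p (real t) = fence_count t w"
proof (induction w rule: resolve_induct)
  case (chain n)
  show ?case
  proof (induction n)
    case 0
    show ?case by (intro exI[of _ "[:0, 1:]"]) (simp add: fence_count_def)
  next
    case (Suc n)
    then obtain p where p: "\<And>t. poly p (real t) = fence_count t (replicate n False)" by blast
    have "fence_count t (replicate (Suc n) False) =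
          poly (smult (1 / real (Suc (Suc n))) (p * [:real (Suc n), 1:])) (real t)" for t
      using fence_count_replicate_Suc[of n t] by (simp add: p field_simps)
    thus ?case by metis
  qed
next
  case (resolve u v)
  then obtain p q r s where "\<And>t. poly p (real t) = fence_count t u"
    "\<And>t. poly q (real t) = fence_count t v" "\<And>t. poly r (real t) = fence_count t (u @ v)"
    "\<And>t. poly s (real t) = fence_count t (u @ False # v)" by blast
  hence "poly (p * q + r - s) (real t) = fence_count t (u @ True # v)" for t
    using fence_count_resolve[of t u v] by simp
  thus ?case by blast
qed

text \<open>The order polynomial of a fence, in the version for weakly order-preserving labellings.\<close>

definition fence_poly :: "bool list \<Rightarrow> real poly" where
  "fence_poly w = (SOME p. \<forall>t::nat. poly p (real t) = fence_count t w)"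

lemma poly_fence_poly: "poly (fence_poly w) (real t) = fence_count t w"
  using someI_ex[OF fence_poly_exists[of w]] by (simp add: fence_poly_def)

lemma coeff_0_fence_poly: "coeff (fence_poly w) 0 = 0"
  using poly_fence_poly[of w 0] by (simp add: fence_count_def poly_0_coeff_0)

lemma poly_0_fence_poly: "poly (fence_poly w) 0 = 0"
  by (simp add: poly_0_coeff_0 coeff_0_fence_poly)

lemma fence_poly_resolve:
  "fence_poly (u @ True # v) + fence_poly (u @ False # v) =
   fence_poly u * fence_poly v + fence_poly (u @ v)"
  by (rule poly_eqI_nat) (simp add: poly_fence_poly fence_count_resolve)

section \<open>The derivative of a fence polynomial\<close>

text \<open>\<open>cut_sum c f g w\<close> is the sum of \<open>f u * g v\<close> over all factorizations
  \<open>w = u @ c # v\<close>.\<close>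

fun cut_sum :: "bool \<Rightarrow> (bool list \<Rightarrow> 'a::comm_ring_1) \<Rightarrow> (bool list \<Rightarrow> 'a) \<Rightarrow> bool list \<Rightarrow> 'a" where
  "cut_sum c f g [] = 0"
| "cut_sum c f g (x # w) = (if x = c then f [] * g w else 0) + cut_sum c (\<lambda>u. f (x # u)) g w"

text \<open>\<open>resolve f u v\<close> measures how far \<open>f\<close> is from being additive when the letter between
  \<open>u\<close> and \<open>v\<close> is resolved into both possibilities and contracted.\<close>

definition resolve :: "(bool list \<Rightarrow> 'a::comm_ring_1) \<Rightarrow> bool list \<Rightarrow> bool list \<Rightarrow> 'a" where
  "resolve f u v = f (u @ True # v) + f (u @ False # v) - f (u @ v)"

lemma cut_sum_add_left:
  "cut_sum c (\<lambda>u. f u + f' u) g w = cut_sum c f g w + cut_sum c f' g w"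
  by (induction w arbitrary: f f') (auto simp: algebra_simps)

lemma cut_sum_diff_left:
  "cut_sum c (\<lambda>u. f u - f' u) g w = cut_sum c f g w - cut_sum c f' g w"
  by (induction w arbitrary: f f') (auto simp: algebra_simps)

lemma cut_sum_scale_left: "cut_sum c (\<lambda>u. a * f u) g w = a * cut_sum c f g w"
  by (induction w arbitrary: f) (auto simp: algebra_simps)

lemma cut_sum_scale_left': "cut_sum c (\<lambda>u. f u * a) g w = cut_sum c f g w * a"
  by (induction w arbitrary: f) (auto simp: algebra_simps)

lemma cut_sum_scale_right: "cut_sum c f (\<lambda>v. g v * a) w = cut_sum c f g w * a"
  by (induction w arbitrary: f) (auto simp: algebra_simps)

lemma cut_sum_zero_right: "cut_sum c f (\<lambda>v. 0) w = 0"
  by (induction w arbitrary: f) auto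

text \<open>The cut lies to the left of the resolved letter, at that letter (for exactly one of its two
  values), or to the right of it.\<close>

lemma resolve_cut_sum:
  "resolve (cut_sum c f g) u v =
   cut_sum c f (\<lambda>w. resolve g w v) u + f u * g v + cut_sum c (\<lambda>w. resolve f u w) g v"
proof (induction u arbitrary: f)
  case Nil
  show ?case
    by (cases c) (simp_all add: resolve_def cut_sum_add_left cut_sum_diff_left algebra_simps)
next
  case (Cons x u)
  from Cons[of "\<lambda>u. f (x # u)"] show ?case
    by (auto simp: resolve_def algebra_simps)
qed

lemma nonneg_poly_cut_sum:
  assumes "\<And>u v. w = u @ c # v \<Longrightarrow> nonneg_poly (f u * g v)"
  shows "nonneg_poly (cut_sum c f g w)"
  using assms
proof (induction w arbitrary: f)
  case (Cons x w)
  have "nonneg_poly (cut_sum c (\<lambda>u. f (x # u)) g w)"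
    by (intro Cons.IH Cons.prems) simp
  thus ?case
    using Cons.prems[of "[]" w] by (auto intro: nonneg_poly_add)
qed (simp add: nonneg_poly_0)

lemma cut_sum_replicate:
  "cut_sum c f g (replicate n c) = (\<Sum>i<n. f (replicate i c) * g (replicate (n - Suc i) c))"
proof (induction n arbitrary: f)
  case (Suc n)
  show ?case by (subst sum.lessThan_Suc_shift) (simp add: Suc)
qed simp

lemma cut_sum_replicate_neq: "c \<noteq> d \<Longrightarrow> cut_sum c f g (replicate n d) = 0"
  by (induction n arbitrary: f) auto

text \<open>The linear coefficient of the order polynomial of a fence: it only depends on the numbers
  \<open>a\<close>, \<open>b\<close> of ascending and descending steps, and equals the beta integral of
  \<open>x ^ a * (1 - x) ^ b\<close> over the unit interval.\<close>

definition fence_linear :: "bool list \<Rightarrow> real poly" where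
  "fence_linear w =
     [:fact (count_list w True) * fact (count_list w False) / fact (Suc (length w)):]"

text \<open>In terms of the beta integral this is \<open>x + (1 - x) = 1\<close>.\<close>

lemma resolve_fence_linear: "resolve fence_linear u v = 0"
proof -
  define a b where "a = count_list (u @ v) True" and "b = count_list (u @ v) False"
  have len: "length w = count_list w True + count_list w False" for w
    by (induction w) auto
  have "(fact (Suc a) * fact b + fact a * fact (Suc b)) / fact (Suc (Suc (a + b))) =
        (fact a * fact b / fact (Suc (a + b)) :: real)"
    by (simp add: divide_simps) (simp add: algebra_simps)
  thus ?thesis
    using len[of "u @ v"]
    by (simp add: resolve_def fence_linear_def a_def b_def add_divide_distrib add_ac del: fact_Suc)
qed

text \<open>The labels close to \<open>0\<close> form a down-set of the fence. To first order this is one connected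
  piece, which is preceded by a descent and followed by an ascent, unless it reaches the end of the
  fence. \<open>fence_left\<close> collects the possibilities on the left of that piece and
  \<open>fence_deriv\<close> those on both sides.\<close>

definition fence_left :: "bool list \<Rightarrow> real poly" where
  "fence_left w = fence_linear w + cut_sum False fence_poly fence_linear w"

definition fence_deriv :: "bool list \<Rightarrow> real poly" where
  "fence_deriv w = fence_left w + cut_sum True fence_left fence_poly w"

lemma resolve_fence_poly: "resolve fence_poly u v = fence_poly u * fence_poly v"
  by (simp add: resolve_def fence_poly_resolve)

lemma resolve_fence_left: "resolve fence_left u v = fence_poly u * fence_left v"
proof -
  have "resolve fence_left u v =
        resolve fence_linear u v + resolve (cut_sum False fence_poly fence_linear) u v"
    by (simp add: resolve_def fence_left_def)
  also have "\<dots> = fence_poly u * fence_left v"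
    by (simp add: resolve_fence_linear resolve_cut_sum resolve_fence_poly cut_sum_zero_right
        cut_sum_scale_left cut_sum_scale_left' fence_left_def algebra_simps)
  finally show ?thesis .
qed

lemma resolve_fence_deriv:
  "resolve fence_deriv u v = fence_poly u * fence_deriv v + fence_deriv u * fence_poly v"
proof -
  have "resolve fence_deriv u v =
        resolve fence_left u v + resolve (cut_sum True fence_left fence_poly) u v"
    by (simp add: resolve_def fence_deriv_def)
  also have "\<dots> = fence_poly u * fence_deriv v + fence_deriv u * fence_poly v"
    by (simp add: resolve_fence_left resolve_cut_sum resolve_fence_poly cut_sum_scale_right
        cut_sum_scale_left cut_sum_scale_left'
        fence_deriv_def algebra_simps)
  finally show ?thesis .
qed

abbreviation chain_poly :: "nat \<Rightarrow> real poly" where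
  "chain_poly n \<equiv> fence_poly (replicate n False)"

lemma chain_poly_0: "chain_poly 0 = [:0, 1:]"
  by (rule poly_eqI_nat) (simp add: poly_fence_poly[of "[]"] fence_count_def)

lemma chain_poly_Suc:
  "smult (real (Suc (Suc n))) (chain_poly (Suc n)) = chain_poly n * [:real (Suc n), 1:]"
  using fence_count_replicate_Suc[of n]
  by (intro poly_eqI_nat) (simp add: poly_fence_poly algebra_simps del: replicate_Suc)

lemma poly_pderiv_chain_poly: "poly (pderiv (chain_poly n)) 0 = 1 / real (Suc n)"
proof (induction n)
  case 0
  have "pderiv (chain_poly 0) = 1" unfolding chain_poly_0 by (simp add: pderiv_pCons)
  thus ?case by simp
next
  case (Suc n)
  have "real (Suc (Suc n)) * poly (pderiv (chain_poly (Suc n))) 0 =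
        poly (pderiv (smult (real (Suc (Suc n))) (chain_poly (Suc n)))) 0"
    by (simp only: pderiv_smult poly_smult)
  also have "\<dots> = 1"
    unfolding chain_poly_Suc pderiv_mult by (simp add: poly_0_fence_poly Suc del: of_nat_Suc)
  finally show ?case by (simp add: field_simps)
qed

lemma chain_poly_shift:
  "pcompose (chain_poly (Suc n)) [:1, 1:] - chain_poly (Suc n) = pcompose (chain_poly n) [:1, 1:]"
proof (rule poly_eqI_nat)
  fix t :: nat
  have "poly (pcompose q [:1, 1:]) (real t) = poly q (real (Suc t))" for q :: "real poly"
    by (simp add: poly_pcompose)
  thus "poly (pcompose (chain_poly (Suc n)) [:1, 1:] - chain_poly (Suc n)) (real t) =
        poly (pcompose (chain_poly n) [:1, 1:]) (real t)"
    by (simp add: poly_fence_poly fence_count_replicate del: replicate_Suc of_nat_Suc)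
qed

lemma fence_deriv_replicate:
  "fence_deriv (replicate n False) =
   [:1 / real (Suc n):] + (\<Sum>i<n. smult (1 / real (n - i)) (chain_poly i))"
proof -
  have lin: "fence_linear (replicate m False) = [:1 / real (Suc m):]" for m
  proof -
    have "count_list (replicate m False) True = 0" "count_list (replicate m False) False = m"
      by (induction m) auto
    thus ?thesis by (simp add: fence_linear_def)
  qed
  have "cut_sum False fence_poly fence_linear (replicate n False) =
        (\<Sum>i<n. smult (1 / real (n - i)) (chain_poly i))"
    unfolding cut_sum_replicate lin by (intro sum.cong) (auto simp: Suc_diff_Suc)
  thus ?thesis
    by (simp add: fence_deriv_def fence_left_def lin cut_sum_replicate_neq)
qed

text \<open>Both sides have the same value at \<open>0\<close>, and their forward differences agree by
  induction on \<open>n\<close>.\<close>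

lemma pderiv_chain_poly: "pderiv (chain_poly n) = fence_deriv (replicate n False)"
proof (induction n)
  case 0
  show ?case
    unfolding fence_deriv_replicate chain_poly_0 by (simp add: pderiv_pCons)
next
  case (Suc n)
  let ?s = "\<lambda>p::real poly. pcompose p [:1, 1:]"
  define D where "D = pderiv (chain_poly (Suc n)) - fence_deriv (replicate (Suc n) False)"
  have "?s (pderiv (chain_poly (Suc n))) - pderiv (chain_poly (Suc n)) =
        pderiv (?s (chain_poly (Suc n)) - chain_poly (Suc n))"
    by (simp only: pderiv_diff pderiv_pcompose) (simp add: pderiv_pCons)
  also have "\<dots> = ?s (pderiv (chain_poly n))"
    by (simp only: chain_poly_shift pderiv_pcompose) (simp add: pderiv_pCons)
  finally have 1: "?s (pderiv (chain_poly (Suc n))) - pderiv (chain_poly (Suc n)) =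
    ?s (fence_deriv (replicate n False))" by (simp only: Suc)
  have s0: "?s (chain_poly 0) - chain_poly 0 = 1"
    unfolding chain_poly_0 by (simp add: pcompose_pCons)
  have "?s (fence_deriv (replicate (Suc n) False)) - fence_deriv (replicate (Suc n) False) =
        (\<Sum>i<Suc n. smult (1 / real (Suc n - i)) (?s (chain_poly i) - chain_poly i))"
    unfolding fence_deriv_replicate
    by (simp only: pcompose_add pcompose_const pcompose_sum pcompose_smult smult_diff_right
        sum_subtractf)
  also have "\<dots> = smult (1 / real (Suc n)) 1 +
      (\<Sum>i<n. smult (1 / real (n - i)) (?s (chain_poly i)))"
    unfolding sum.lessThan_Suc_shift s0 chain_poly_shift by simp
  also have "\<dots> = ?s (fence_deriv (replicate n False))"
    unfolding fence_deriv_replicate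
    by (simp only: pcompose_add pcompose_const pcompose_sum pcompose_smult smult_one)
  finally have "?s D - D = 0"
    using 1 unfolding D_def by (simp only: pcompose_diff)
  hence step: "poly D (real (Suc t)) = poly D (real t)" for t
  proof -
    have "poly (?s D) (real t) = poly D (real t)"
      using \<open>?s D - D = 0\<close> by simp
    thus ?thesis by (simp add: poly_pcompose)
  qed
  have "poly D 0 = 0"
    unfolding D_def fence_deriv_replicate poly_diff poly_pderiv_chain_poly
    by (simp add: poly_sum poly_0_fence_poly)
  hence "poly D (real t) = 0" for t
    by (induction t) (use step in auto)
  hence "D = 0" by (intro poly_eqI_nat) simp
  thus ?case by (simp add: D_def)
qed

theorem pderiv_fence_poly: "pderiv (fence_poly w) = fence_deriv w"
proof (induction w rule: resolve_induct)
  case (chain n)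
  show ?case by (rule pderiv_chain_poly)
next
  case (resolve u v)
  have "fence_poly (u @ True # v) =
        fence_poly u * fence_poly v + fence_poly (u @ v) - fence_poly (u @ False # v)"
    using fence_poly_resolve[of u v] by (simp only: eq_diff_eq)
  hence "pderiv (fence_poly (u @ True # v)) =
        pderiv (fence_poly u * fence_poly v + fence_poly (u @ v) - fence_poly (u @ False # v))"
    by (rule arg_cong)
  also have "\<dots> = fence_poly u * fence_deriv v + fence_deriv u * fence_poly v +
      fence_deriv (u @ v) - fence_deriv (u @ False # v)"
    by (simp add: pderiv_diff pderiv_add pderiv_mult resolve algebra_simps)
  also have "\<dots> = fence_deriv (u @ True # v)"
    using resolve_fence_deriv[of u v] by (simp add: resolve_def algebra_simps)
  finally show ?case .
qed

theorem nonneg_fence_poly: "nonneg_poly (fence_poly w)"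
proof (induction w rule: length_induct)
  case (1 w)
  have IH: "nonneg_poly (fence_poly v)" if "length v < length w" for v
    using 1 that by simp
  have lin: "nonneg_poly (fence_linear v)" for v
    unfolding fence_linear_def by (intro nonneg_poly_const) simp
  have left: "nonneg_poly (fence_left v)" if "length v \<le> length w" for v
    unfolding fence_left_def
    by (intro nonneg_poly_add nonneg_poly_cut_sum nonneg_poly_mult lin IH) (use that in simp)
  have "nonneg_poly (fence_deriv w)"
    unfolding fence_deriv_def
    by (intro nonneg_poly_add nonneg_poly_cut_sum nonneg_poly_mult left IH) simp_all
  thus ?case
    using nonneg_poly_integrate[of "fence_poly w"]
    by (simp add: pderiv_fence_poly coeff_0_fence_poly)
qed

section \<open>Counting integer sequences under a lattice path\<close>

text \<open>The sequences of length \<open>length U\<close> with entries in \<open>{..t}\<close> whose partial sums stay below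
  the \<open>t\<close>-fold height profile of \<open>U\<close>, raised by \<open>d\<close>, and reach it at the end. The number \<open>d\<close>
  is the slack at the start, by which the partial sums fall short of their bound.\<close>

definition dominated_seqs :: "nat \<Rightarrow> step list \<Rightarrow> nat \<Rightarrow> nat list set" where
  "dominated_seqs t U d = {ys. length ys = length U \<and> set ys \<subseteq> {..t} \<and>
     (\<forall>j\<le>length U. sum_list (take j ys) \<le> d + t * count_list (take j U) North) \<and>
     sum_list ys = d + t * count_list U North}"

text \<open>Their number, by recursion over the slack after each step.\<close>

fun slack_count :: "nat \<Rightarrow> step list \<Rightarrow> nat \<Rightarrow> real" where
  "slack_count t [] d = (if d = 0 then 1 else 0)"
| "slack_count t (East # U) d = (\<Sum>d'\<in>{d - t..d}. slack_count t U d')"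
| "slack_count t (North # U) d = (\<Sum>d'\<in>{d..d + t}. slack_count t U d')"

lemma dominated_seqs_Cons:
  fixes d t :: nat and s :: step
  defines "e \<equiv> d + (if s = North then t else 0)"
  shows "dominated_seqs t (s # U) d =
    (\<Union>d'\<in>{e - t..e}. (#) (e - d') ` dominated_seqs t U d')"
proof (intro equalityI subsetI)
  fix ys assume ys: "ys \<in> dominated_seqs t (s # U) d"
  then obtain y zs where yz: "ys = y # zs"
    by (cases ys) (auto simp: dominated_seqs_def)
  have dom: "sum_list (take j ys) \<le> d + t * count_list (take j (s # U)) North"
    if "j \<le> Suc (length U)" for j
    using ys that by (simp add: dominated_seqs_def)
  have y: "y \<le> t" "y \<le> e"
    using ys dom[of 1] by (auto simp: dominated_seqs_def yz e_def split: if_splits)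
  have "y + sum_list (take j zs) \<le> e + t * count_list (take j U) North" if "j \<le> length U" for j
    using dom[of "Suc j"] that by (auto simp: yz e_def split: if_splits)
  hence "sum_list (take j zs) \<le> e - y + t * count_list (take j U) North" if "j \<le> length U" for j
    using that y by fastforce
  moreover have "sum_list zs = e - y + t * count_list U North"
    using ys y by (auto simp: dominated_seqs_def yz e_def split: if_splits)
  ultimately have "zs \<in> dominated_seqs t U (e - y)"
    using ys by (auto simp: dominated_seqs_def yz)
  thus "ys \<in> (\<Union>d'\<in>{e - t..e}. (#) (e - d') ` dominated_seqs t U d')"
    using y by (intro UN_I[of "e - y"]) (auto simp: yz)
next
  fix ys assume "ys \<in> (\<Union>d'\<in>{e - t..e}. (#) (e - d') ` dominated_seqs t U d')"
  then obtain d' zs where d': "d' \<in> {e - t..e}" and zs: "zs \<in> dominated_seqs t U d'"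
    and ys: "ys = (e - d') # zs" by blast
  have "sum_list (take j ys) \<le> d + t * count_list (take j (s # U)) North"
    if "j \<le> Suc (length U)" for j
  proof (cases j)
    case (Suc i)
    have "sum_list (take i zs) \<le> d' + t * count_list (take i U) North"
      using zs that Suc by (simp add: dominated_seqs_def)
    thus ?thesis using d' Suc by (auto simp: ys e_def)
  qed simp
  thus "ys \<in> dominated_seqs t (s # U) d"
    using zs d' by (auto simp: dominated_seqs_def ys e_def)
qed

lemma slack_count_Cons:
  "slack_count t (s # U) d =
   (\<Sum>d'\<in>{d + (if s = North then t else 0) - t..d + (if s = North then t else 0)}.
      slack_count t U d')"
  by (cases s) auto

lemma card_dominated_seqs:
  "finite (dominated_seqs t U d) \<and> real (card (dominated_seqs t U d)) = slack_count t U d"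
proof (induction U arbitrary: d)
  case Nil
  have "dominated_seqs t [] d = (if d = 0 then {[]} else {})"
    by (auto simp: dominated_seqs_def)
  thus ?case by simp
next
  case (Cons s U)
  define e where "e = d + (if s = North then t else 0)"
  have "card (\<Union>d'\<in>{e - t..e}. (#) (e - d') ` dominated_seqs t U d') =
        (\<Sum>d'\<in>{e - t..e}. card ((#) (e - d') ` dominated_seqs t U d'))"
    by (intro card_UN_disjoint) (use Cons in auto)
  thus ?case
    unfolding dominated_seqs_Cons slack_count_Cons e_def[symmetric]
    using Cons by (simp add: card_image)
qed

text \<open>Functions of \<open>t\<close> and the first label \<open>r < t\<close> that combine fence counts with nonnegative
  polynomials in \<open>t\<close> as coefficients. The values at \<open>r \<ge> t\<close> are irrelevant, whence the rule
  \<open>cong\<close>.\<close>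

inductive fence_comb :: "(nat \<Rightarrow> nat \<Rightarrow> real) \<Rightarrow> bool" where
  zero: "fence_comb (\<lambda>t r. 0)"
| fence: "nonneg_poly p \<Longrightarrow> fence_comb (\<lambda>t r. poly p (real t) * fence_from t w r)"
| add: "fence_comb f \<Longrightarrow> fence_comb g \<Longrightarrow> fence_comb (\<lambda>t r. f t r + g t r)"
| cong: "fence_comb f \<Longrightarrow> (\<And>t r. r < t \<Longrightarrow> g t r = f t r) \<Longrightarrow> fence_comb g"

lemma fence_comb_const: "nonneg_poly p \<Longrightarrow> fence_comb (\<lambda>t r. poly p (real t))"
  using fence_comb.fence[of p "[]"] by simp

lemma fence_comb_ascent: "fence_comb f \<Longrightarrow> fence_comb (\<lambda>t r. \<Sum>r'\<in>{r..<t}. f t r')"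
proof (induction rule: fence_comb.induct)
  case zero
  show ?case by (simp add: fence_comb.zero)
next
  case (fence p w)
  thus ?case using fence_comb.fence[of p "True # w"] by (simp add: sum_distrib_left)
next
  case (add f g)
  thus ?case using fence_comb.add by (simp add: sum.distrib)
next
  case (cong f g)
  show ?case by (rule fence_comb.cong[OF cong.IH]) (auto intro!: sum.cong cong.hyps)
qed

lemma fence_comb_descent: "fence_comb f \<Longrightarrow> fence_comb (\<lambda>t r. \<Sum>r'\<le>r. f t r')"
proof (induction rule: fence_comb.induct)
  case zero
  show ?case by (simp add: fence_comb.zero)
next
  case (fence p w)
  thus ?case using fence_comb.fence[of p "False # w"] by (simp add: sum_distrib_left)
next
  case (add f g)
  thus ?case using fence_comb.add by (simp add: sum.distrib)
next
  case (cong f g)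
  show ?case by (rule fence_comb.cong[OF cong.IH]) (auto intro!: sum.cong cong.hyps)
qed

lemma fence_comb_total:
  "fence_comb f \<Longrightarrow> \<exists>p. nonneg_poly p \<and> (\<forall>t. (\<Sum>r<t. f t r) = poly p (real t))"
proof (induction rule: fence_comb.induct)
  case zero
  show ?case by (intro exI[of _ 0]) (simp add: nonneg_poly_0)
next
  case (fence p w)
  have "(\<Sum>r<t. poly p (real t) * fence_from t w r) = poly (p * fence_poly w) (real t)" for t
    by (simp add: poly_fence_poly fence_count_def sum_distrib_left)
  thus ?case using fence nonneg_fence_poly nonneg_poly_mult by blast
next
  case (add f g)
  then obtain p q where "nonneg_poly p" "nonneg_poly q"
    "\<And>t. (\<Sum>r<t. f t r) = poly p (real t)" "\<And>t. (\<Sum>r<t. g t r) = poly q (real t)" by blast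
  thus ?case by (intro exI[of _ "p + q"]) (simp add: nonneg_poly_add sum.distrib)
next
  case (cong f g)
  hence "(\<Sum>r<t. g t r) = (\<Sum>r<t. f t r)" for t by (intro sum.cong) auto
  thus ?case using cong.IH by metis
qed

text \<open>A window of \<open>t + 1\<close> slacks that starts inside one block ends inside the next.\<close>

lemma sum_window:
  fixes F :: "nat \<Rightarrow> real"
  assumes "r < t"
  shows "(\<Sum>d\<in>{a + Suc r..a + Suc r + t}. F d) =
         (\<Sum>r'\<in>{r..<t}. F (a + Suc r')) + (\<Sum>r'\<le>r. F (a + t + Suc r'))"
proof -
  have "{a + Suc r..a + Suc r + t} =
        (\<lambda>r'. a + Suc r') ` {r..<t} \<union> (\<lambda>r'. a + t + Suc r') ` {..r}" (is "_ = ?A \<union> ?B")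
  proof (intro equalityI subsetI)
    fix d assume d: "d \<in> {a + Suc r..a + Suc r + t}"
    show "d \<in> ?A \<union> ?B"
    proof (cases "d \<le> a + t")
      case True
      hence "d = a + Suc (d - Suc a)" "d - Suc a \<in> {r..<t}" using d by auto
      thus ?thesis by blast
    next
      case False
      hence "d = a + t + Suc (d - Suc (a + t))" "d - Suc (a + t) \<in> {..r}" using d by auto
      thus ?thesis by blast
    qed
  qed (use assms in auto)
  moreover have "?A \<inter> ?B = {}" by auto
  ultimately show ?thesis
    by (simp add: sum.union_disjoint sum.reindex inj_on_def)
qed

lemma sum_atMost_shift0: "(\<Sum>d\<le>r. F d) = F 0 + (\<Sum>r'<r. F (Suc r'))" for F :: "nat \<Rightarrow> real"
  by (simp add: lessThan_Suc_atMost[symmetric] sum.lessThan_Suc_shift del: sum.lessThan_Suc)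

text \<open>A slack is either \<open>0\<close> or of the form \<open>h * t + r + 1\<close> with \<open>r < t\<close>. In the second case
  one step keeps the block \<open>h\<close> or moves to a neighbouring one, and the
  residue \<open>r\<close> weakly increases or decreases accordingly; so the residues label a fence as long
  as the slack is positive. On a return to slack \<open>0\<close> the fence ends, and the rest of the path
  contributes a factor that does not depend on \<open>r\<close>.\<close>

lemma slack_count_positive:
  "(\<exists>p. nonneg_poly p \<and> (\<forall>t. slack_count t U 0 = poly p (real t))) \<and>
   (\<forall>h. fence_comb (\<lambda>t r. slack_count t U (h * t + Suc r)))"
proof (induction U)
  case Nil
  have "fence_comb (\<lambda>t r. slack_count t [] (h * t + Suc r))" for h
    by (simp add: fence_comb.zero)
  thus ?case by (intro conjI exI[of _ "[:1:]"]) (auto intro: nonneg_poly_const)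
next
  case (Cons s U)
  then obtain p where p: "nonneg_poly p" "\<And>t. slack_count t U 0 = poly p (real t)"
    by blast
  have comb: "fence_comb (\<lambda>t r. slack_count t U (h * t + Suc r))" for h
    using Cons by blast
  have window: "fence_comb (\<lambda>t r. \<Sum>d\<in>{h * t + Suc r..h * t + Suc r + t}. slack_count t U d)" for h
  proof (rule fence_comb.cong)
    show "fence_comb (\<lambda>t r. (\<Sum>r'\<in>{r..<t}. slack_count t U (h * t + Suc r')) +
                            (\<Sum>r'\<le>r. slack_count t U (Suc h * t + Suc r')))"
      by (intro fence_comb.add fence_comb_ascent fence_comb_descent comb)
    fix t r :: nat assume "r < t"
    thus "(\<Sum>d\<in>{h * t + Suc r..h * t + Suc r + t}. slack_count t U d) =
          (\<Sum>r'\<in>{r..<t}. slack_count t U (h * t + Suc r')) +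
          (\<Sum>r'\<le>r. slack_count t U (Suc h * t + Suc r'))"
      using sum_window[of r t "slack_count t U" "h * t"] by (simp only: mult_Suc add.commute)
  qed
  show ?case
  proof (cases s)
    case East
    have "fence_comb (\<lambda>t r. slack_count t (s # U) (h * t + Suc r))" for h
    proof (cases h)
      case 0
      show ?thesis
      proof (rule fence_comb.cong)
        show "fence_comb (\<lambda>t r. poly p (real t) + (\<Sum>r'\<le>r. slack_count t U (0 * t + Suc r')))"
          by (intro fence_comb.add fence_comb_const fence_comb_descent p comb)
        fix t r :: nat assume "r < t"
        hence "slack_count t (s # U) (h * t + Suc r) = (\<Sum>d\<le>Suc r. slack_count t U d)"
          by (simp add: 0 East atMost_atLeast0 del: sum.cl_ivl_Suc)
        thus "slack_count t (s # U) (h * t + Suc r) =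
              poly p (real t) + (\<Sum>r'\<le>r. slack_count t U (0 * t + Suc r'))"
          by (simp add: sum_atMost_shift0 p lessThan_Suc_atMost del: sum.atMost_Suc sum.lessThan_Suc)
      qed
    next
      case (Suc i)
      have "slack_count t (s # U) (h * t + Suc r) =
            (\<Sum>d\<in>{i * t + Suc r..i * t + Suc r + t}. slack_count t U d)" for t r
        by (simp add: Suc East add_ac)
      thus ?thesis using window[of i] by presburger
    qed
    thus ?thesis using p East by auto
  next
    case North
    have "fence_comb (\<lambda>t r. slack_count t (s # U) (h * t + Suc r))" for h
      using window[of h] by (simp add: North)
    moreover obtain q where q: "nonneg_poly q"
      "\<And>t. (\<Sum>r<t. slack_count t U (0 * t + Suc r)) = poly q (real t)"
      using fence_comb_total[OF comb] by blast
    moreover have "slack_count t (s # U) 0 = poly (p + q) (real t)" for t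
      using q(2)[of t] by (simp add: North sum_atMost_shift0 p flip: atMost_atLeast0)
    ultimately show ?thesis using p nonneg_poly_add by blast
  qed
qed

section \<open>Lattice points of the base polytope\<close>

lemma card_north_steps_Int:
  assumes "m \<le> length P"
  shows "card (north_steps P \<inter> {1..m}) = count_list (take m P) North"
proof -
  have "north_steps P \<inter> {1..m} = {i \<in> {1..length (take m P)}. take m P ! (i - 1) = North}"
    using assms by (auto simp: north_steps_def)
  thus ?thesis by (simp add: count_list_eq_card)
qed

text \<open>The lower path of a Schubert matroid imposes no condition.\<close>

lemma card_bottom_path_Int_le:
  assumes A: "A \<subseteq> {1..n}" "card A = k" and "m \<le> n"
  shows "card (north_steps (bottom_path n k) \<inter> {1..m}) \<le> card (A \<inter> {1..m})"
proof -
  have "north_steps (bottom_path n k) \<inter> {1..m} \<subseteq> {n - k<..m}"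
    by (auto simp: north_steps_def bottom_path_def nth_append split: if_splits)
  hence 1: "card (north_steps (bottom_path n k) \<inter> {1..m}) \<le> m - (n - k)"
    using card_mono[of "{n - k<..m}"] by simp
  have "A \<subseteq> (A \<inter> {1..m}) \<union> {m<..n}" using A by auto
  hence "card A \<le> card ((A \<inter> {1..m}) \<union> {m<..n})" by (intro card_mono) auto
  also have "\<dots> \<le> card (A \<inter> {1..m}) + (n - m)"
    using card_Un_le[of "A \<inter> {1..m}" "{m<..n}"] by simp
  finally have "k \<le> card (A \<inter> {1..m}) + (n - m)" using A by simp
  thus ?thesis using 1 \<open>m \<le> n\<close> by linarith
qed

text \<open>\<open>\<sigma>\<close> enumerates the ground set, starting with index \<open>0\<close>, in the order in which the path
  \<open>U\<close> runs through it.\<close>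

lemma schubert_matroid_bases:
  assumes "schubert_matroid M"
  obtains U \<sigma> where "bij_betw \<sigma> {..<length U} (ground M)"
    "bases M = {A. A \<subseteq> ground M \<and>
       (\<forall>m\<le>length U. card {j. j < m \<and> \<sigma> j \<in> A} \<le> count_list (take m U) North) \<and>
       card {j. j < length U \<and> \<sigma> j \<in> A} = count_list U North}"
proof -
  from assms obtain n k U \<phi> where M: "is_matroid M" and U: "U \<in> lattice_paths n k"
    and \<phi>: "bij_betw \<phi> (ground M) {1..n}"
    and iso: "\<And>A. A \<subseteq> ground M \<Longrightarrow>
      A \<in> bases M \<longleftrightarrow> \<phi> ` A \<in> bases (lattice_path_matroid n k (bottom_path n k) U)"
    by (auto simp: schubert_matroid_def matroid_iso_def lattice_path_matroid_def ground_def)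
  define \<sigma> where "\<sigma> j = inv_into (ground M) \<phi> (Suc j)" for j
  have len: "length U = n" and k: "count_list U North = k"
    using U by (auto simp: lattice_paths_def)
  have "bij_betw Suc {..<n} {1..n}"
    by (intro bij_betwI[of _ _ _ "\<lambda>j. j - 1"]) auto
  from bij_betw_trans[OF this bij_betw_inv_into[OF \<phi>]]
  have \<sigma>: "bij_betw \<sigma> {..<n} (ground M)"
    by (simp add: \<sigma>_def[abs_def] o_def)
  have \<phi>\<sigma>: "\<phi> (\<sigma> j) = Suc j" if "j < n" for j
    unfolding \<sigma>_def using \<phi> that by (intro f_inv_into_f) (auto simp: bij_betw_def)
  have \<sigma>\<phi>: "\<sigma> (\<phi> x - 1) = x" if "x \<in> ground M" for x
  proof -
    have "\<phi> x \<ge> 1" using \<phi> that by (auto simp: bij_betw_def)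
    thus ?thesis unfolding \<sigma>_def using \<phi> that by (simp add: bij_betw_def inv_into_f_f)
  qed
  have image: "\<phi> ` A \<inter> {1..m} = Suc ` {j. j < m \<and> \<sigma> j \<in> A}"
    if "A \<subseteq> ground M" "m \<le> n" for A m
  proof (intro equalityI subsetI)
    fix i assume "i \<in> \<phi> ` A \<inter> {1..m}"
    then obtain x where "x \<in> A" "i = \<phi> x" "1 \<le> i" "i \<le> m" by auto
    thus "i \<in> Suc ` {j. j < m \<and> \<sigma> j \<in> A}"
      using \<sigma>\<phi>[of x] that by (intro image_eqI[of _ _ "i - 1"]) auto
  next
    fix i assume "i \<in> Suc ` {j. j < m \<and> \<sigma> j \<in> A}"
    then obtain j where "i = Suc j" "j < m" "\<sigma> j \<in> A" by auto
    thus "i \<in> \<phi> ` A \<inter> {1..m}"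
      using \<phi>\<sigma>[of j] that by (auto intro!: image_eqI[of _ _ "\<sigma> j"])
  qed
  have card: "card (\<phi> ` A \<inter> {1..m}) = card {j. j < m \<and> \<sigma> j \<in> A}"
    if "A \<subseteq> ground M" "m \<le> n" for A m
    unfolding image[OF that] by (simp add: card_image)
  have sub: "\<phi> ` A \<subseteq> {1..n}" if "A \<subseteq> ground M" for A
    using \<phi> that by (auto simp: bij_betw_def)
  have total: "card (\<phi> ` A) = card {j. j < n \<and> \<sigma> j \<in> A}" if "A \<subseteq> ground M" for A
    using card[OF that, of n] sub[OF that] by (simp add: Int_absorb2)
  have iff: "A \<in> bases M \<longleftrightarrow>
     (\<forall>m\<le>n. card {j. j < m \<and> \<sigma> j \<in> A} \<le> count_list (take m U) North) \<and>
     card {j. j < n \<and> \<sigma> j \<in> A} = count_list U North" if A: "A \<subseteq> ground M" for A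
  proof -
    have "A \<in> bases M \<longleftrightarrow> card (\<phi> ` A) = k \<and>
        (\<forall>m\<in>{1..n}. card (\<phi> ` A \<inter> {1..m}) \<le> card (north_steps U \<inter> {1..m}))"
      unfolding iso[OF A] bases_lattice_path_matroid[OF U]
      using sub[OF A] card_bottom_path_Int_le[of "\<phi> ` A" n k] by auto
    also have "\<dots> \<longleftrightarrow> card {j. j < n \<and> \<sigma> j \<in> A} = k \<and>
        (\<forall>m\<in>{1..n}. card {j. j < m \<and> \<sigma> j \<in> A} \<le> count_list (take m U) North)"
      using card[OF A] total[OF A] card_north_steps_Int[of _ U] len by simp
    also have "(\<forall>m\<in>{1..n}. card {j. j < m \<and> \<sigma> j \<in> A} \<le> count_list (take m U) North) \<longleftrightarrow>
        (\<forall>m\<le>n. card {j. j < m \<and> \<sigma> j \<in> A} \<le> count_list (take m U) North)"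
      by (auto simp: Suc_le_eq)
    finally show ?thesis by (simp only: k conj_commute)
  qed
  have sub': "A \<subseteq> ground M" if "A \<in> bases M" for A
    using M that by (simp add: is_matroid_def)
  have "bases M = {A. A \<subseteq> ground M \<and>
     (\<forall>m\<le>n. card {j. j < m \<and> \<sigma> j \<in> A} \<le> count_list (take m U) North) \<and>
     card {j. j < n \<and> \<sigma> j \<in> A} = count_list U North}"
    (is "_ = ?R")
  proof (rule set_eqI)
    fix A show "A \<in> bases M \<longleftrightarrow> A \<in> ?R"
    proof (cases "A \<subseteq> ground M")
      case True
      show ?thesis unfolding mem_Collect_eq iff[OF True] using True by (simp only: simp_thms)
    next
      case False
      hence "A \<notin> bases M" using sub' by (rule contrapos_nn)
      thus ?thesis unfolding mem_Collect_eq using False by (simp only: simp_thms)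
    qed
  qed
  thus ?thesis
    by (intro that[of \<sigma> U]) (simp_all only: len \<sigma>)
qed

text \<open>Hermite's identity.\<close>

lemma sum_add_div:
  fixes z t :: nat
  assumes "t > 0"
  shows "(\<Sum>i<t. (z + i) div t) = z"
proof (induction z)
  case (Suc z)
  have "(\<Sum>i<t. (z + i) div t) + (z + t) div t = (\<Sum>i<Suc t. (z + i) div t)" by simp
  also have "\<dots> = z div t + (\<Sum>i<t. (Suc z + i) div t)"
    by (subst sum.lessThan_Suc_shift) simp
  finally have "(\<Sum>i<t. (z + i) div t) + (z + t) div t = z div t + (\<Sum>i<t. (Suc z + i) div t)" .
  moreover have "(z + t) div t = z div t + 1" using assms by simp
  ultimately show ?case using Suc by linarith
qed simp

lemma convex_constraints:
  fixes \<sigma> :: "nat \<Rightarrow> 'n::finite" and c :: "nat \<Rightarrow> real"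
  shows "convex {x :: real ^ 'n. (\<forall>i. 0 \<le> x $ i \<and> x $ i \<le> 1) \<and> (\<forall>i. i \<notin> G \<longrightarrow> x $ i = 0) \<and>
    (\<forall>m\<le>n. (\<Sum>j<m. x $ \<sigma> j) \<le> c m) \<and> (\<Sum>j<n. x $ \<sigma> j) = c n}" (is "convex ?F")
proof (rule convexI)
  fix x y :: "real ^ 'n" and u v :: real
  assume xy: "x \<in> ?F" "y \<in> ?F" and uv: "0 \<le> u" "0 \<le> v" "u + v = 1"
  have sum: "(\<Sum>j<m. (u *\<^sub>R x + v *\<^sub>R y) $ \<sigma> j) =
             u * (\<Sum>j<m. x $ \<sigma> j) + v * (\<Sum>j<m. y $ \<sigma> j)" for m
    by (simp add: sum.distrib sum_distrib_left)
  have "u * c n + v * c n = c n"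
    using uv by (simp flip: distrib_right)
  thus "u *\<^sub>R x + v *\<^sub>R y \<in> ?F"
    using xy uv unfolding mem_Collect_eq sum by (auto intro!: convex_bound_le)
qed

text \<open>A lattice point of the dilated polytope is the sum of \<open>t\<close> vertices: the vertex with
  number \<open>i < t\<close> has the partial sums \<open>(z m + i) div t\<close>, where \<open>z m\<close> are those of the
  given point.\<close>

lemma card_lattice_points_base_polytope:
  fixes M :: "'n::finite set_system"
  assumes \<sigma>: "bij_betw \<sigma> {..<length U} (ground M)"
    and bases: "bases M = {A. A \<subseteq> ground M \<and>
       (\<forall>m\<le>length U. card {j. j < m \<and> \<sigma> j \<in> A} \<le> count_list (take m U) North) \<and>
       card {j. j < length U \<and> \<sigma> j \<in> A} = count_list U North}"
    and ne: "bases M \<noteq> {}"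
  shows "card ((\<lambda>x. real t *\<^sub>R x) ` base_polytope M \<inter> lattice_points) =
         card (dominated_seqs t U 0)"
proof -
  define n where "n = length U"
  define c where "c m = count_list (take m U) North" for m
  define S where "S = (\<lambda>x. real t *\<^sub>R x) ` base_polytope M \<inter> lattice_points"
  define enc :: "real ^ 'n \<Rightarrow> nat list" where "enc x = map (\<lambda>j. nat \<lfloor>x $ \<sigma> j\<rfloor>) [0..<n]" for x
  have dominated_seqs_iff: "ys \<in> dominated_seqs t U 0 \<longleftrightarrow> length ys = n \<and> set ys \<subseteq> {..t} \<and>
      (\<forall>m\<le>n. sum_list (take m ys) \<le> t * c m) \<and> sum_list ys = t * c n" for ys
    by (simp add: dominated_seqs_def n_def c_def)
  have basis_iff: "A \<in> bases M \<longleftrightarrow> A \<subseteq> ground M \<and>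
      (\<forall>m\<le>n. card {j. j < m \<and> \<sigma> j \<in> A} \<le> c m) \<and> card {j. j < n \<and> \<sigma> j \<in> A} = c n" for A
    unfolding bases by (simp add: n_def c_def)
  have \<sigma>G: "\<sigma> j \<in> ground M" if "j < n" for j
    using \<sigma> that by (auto simp: bij_betw_def n_def)
  have G\<sigma>: "\<exists>j<n. i = \<sigma> j" if "i \<in> ground M" for i
    using \<sigma> that by (auto simp: bij_betw_def n_def image_iff)
  have inj: "i = j" if "\<sigma> i = \<sigma> j" "i < n" "j < n" for i j
    using \<sigma> that by (auto simp: bij_betw_def n_def inj_on_def)
  have ind: "(\<Sum>j<m. indicator_vec A $ \<sigma> j) = real (card {j. j < m \<and> \<sigma> j \<in> A})" for m A
  proof -
    have "(\<Sum>j<m. indicator_vec A $ \<sigma> j) = (\<Sum>j\<in>{j\<in>{..<m}. \<sigma> j \<in> A}. 1)"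
      by (subst sum.inter_filter) (simp_all add: indicator_vec_def)
    thus ?thesis by simp
  qed
  have "base_polytope M \<subseteq> {x. (\<forall>i. 0 \<le> x $ i \<and> x $ i \<le> 1) \<and>
    (\<forall>i. i \<notin> ground M \<longrightarrow> x $ i = 0) \<and>
    (\<forall>m\<le>n. (\<Sum>j<m. x $ \<sigma> j) \<le> real (c m)) \<and> (\<Sum>j<n. x $ \<sigma> j) = real (c n)}"
    unfolding base_polytope_def
  proof (rule hull_minimal)
    show "indicator_vec ` bases M \<subseteq> {x. (\<forall>i. 0 \<le> x $ i \<and> x $ i \<le> 1) \<and>
      (\<forall>i. i \<notin> ground M \<longrightarrow> x $ i = 0) \<and>
      (\<forall>m\<le>n. (\<Sum>j<m. x $ \<sigma> j) \<le> real (c m)) \<and> (\<Sum>j<n. x $ \<sigma> j) = real (c n)}"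
    proof (rule image_subsetI)
      fix A assume "A \<in> bases M"
      hence A: "A \<subseteq> ground M" "\<forall>m\<le>n. card {j. j < m \<and> \<sigma> j \<in> A} \<le> c m"
        "card {j. j < n \<and> \<sigma> j \<in> A} = c n" unfolding basis_iff by blast+
      have "0 \<le> indicator_vec A $ i \<and> indicator_vec A $ i \<le> 1" for i
        by (simp add: indicator_vec_def)
      moreover have "indicator_vec A $ i = 0" if "i \<notin> ground M" for i
        using that A(1) by (auto simp: indicator_vec_def)
      ultimately show "indicator_vec A \<in> {x. (\<forall>i. 0 \<le> x $ i \<and> x $ i \<le> 1) \<and>
        (\<forall>i. i \<notin> ground M \<longrightarrow> x $ i = 0) \<and>
        (\<forall>m\<le>n. (\<Sum>j<m. x $ \<sigma> j) \<le> real (c m)) \<and> (\<Sum>j<n. x $ \<sigma> j) = real (c n)}"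
        using A(2,3) by (simp add: ind)
    qed
  qed (rule convex_constraints)
  hence poly: "0 \<le> p $ i \<and> p $ i \<le> 1" "i \<notin> ground M \<Longrightarrow> p $ i = 0"
    "m \<le> n \<Longrightarrow> (\<Sum>j<m. p $ \<sigma> j) \<le> real (c m)" "(\<Sum>j<n. p $ \<sigma> j) = real (c n)"
    if "p \<in> base_polytope M" for p i m
    using that by auto
  have S: "0 \<le> x $ i \<and> x $ i \<le> real t \<and> (i \<notin> ground M \<longrightarrow> x $ i = 0)"
      "m \<le> n \<Longrightarrow> (\<Sum>j<m. x $ \<sigma> j) \<le> real (t * c m)"
      "(\<Sum>j<n. x $ \<sigma> j) = real (t * c n)"
      "real (nat \<lfloor>x $ i\<rfloor>) = x $ i"
    if "x \<in> S" for x i m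
  proof -
    from that obtain p where p: "p \<in> base_polytope M" and x: "x = real t *\<^sub>R p"
      and int: "x $ i \<in> \<int>" for i
      by (auto simp: S_def lattice_points_def)
    have sum: "(\<Sum>j<m. x $ \<sigma> j) = real t * (\<Sum>j<m. p $ \<sigma> j)" for m
      by (simp add: x sum_distrib_left)
    show 1: "0 \<le> x $ i \<and> x $ i \<le> real t \<and> (i \<notin> ground M \<longrightarrow> x $ i = 0)"
      using poly(1,2)[OF p, of i] by (auto simp: x mult_left_le)
    show "(\<Sum>j<m. x $ \<sigma> j) \<le> real (t * c m)" if "m \<le> n"
      unfolding sum of_nat_mult by (intro mult_left_mono poly(3) p that) simp
    show "(\<Sum>j<n. x $ \<sigma> j) = real (t * c n)"
      by (simp add: sum poly(4)[OF p])
    from int obtain a :: int where "x $ i = of_int a" by (auto elim: Ints_cases)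
    thus "real (nat \<lfloor>x $ i\<rfloor>) = x $ i" using 1 by simp
  qed
  have take_enc: "real (sum_list (take m (enc x))) = (\<Sum>j<m. x $ \<sigma> j)"
    if "x \<in> S" "m \<le> n" for x m
  proof -
    have "sum_list (take m (enc x)) = (\<Sum>j<m. nat \<lfloor>x $ \<sigma> j\<rfloor>)"
      using \<open>m \<le> n\<close>
      by (simp add: enc_def take_map take_upt interv_sum_list_conv_sum_set_nat atLeast0LessThan)
    thus ?thesis by (simp add: S(4)[OF that(1)])
  qed
  have "bij_betw enc S (dominated_seqs t U 0)"
  proof (rule bij_betw_imageI)
    show "inj_on enc S"
    proof (rule inj_onI)
      fix x y assume xy: "x \<in> S" "y \<in> S" "enc x = enc y"
      have "x $ i = y $ i" for i
      proof (cases "i \<in> ground M")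
        case True
        then obtain j where "j < n" "i = \<sigma> j" using G\<sigma> by blast
        hence "nat \<lfloor>x $ i\<rfloor> = nat \<lfloor>y $ i\<rfloor>"
          using arg_cong[OF xy(3), of "\<lambda>l. l ! j"] by (simp add: enc_def)
        thus ?thesis by (metis S(4) xy(1,2))
      next
        case False
        thus ?thesis using S(1)[OF xy(1)] S(1)[OF xy(2)] by metis
      qed
      thus "x = y" by (simp add: vec_eq_iff)
    qed
    have "enc x \<in> dominated_seqs t U 0" if x: "x \<in> S" for x
    proof -
      have "set (enc x) \<subseteq> {..t}"
      proof
        fix y assume "y \<in> set (enc x)"
        then obtain j where "y = nat \<lfloor>x $ \<sigma> j\<rfloor>" by (auto simp: enc_def)
        hence "real y \<le> real t" using S(1,4)[OF x, of "\<sigma> j"] by simp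
        thus "y \<in> {..t}" by simp
      qed
      moreover have "sum_list (take m (enc x)) \<le> t * c m" if "m \<le> n" for m
        using S(2)[OF x that] take_enc[OF x that] by linarith
      moreover have "sum_list (enc x) = t * c n"
      proof -
        have "real (sum_list (enc x)) = real (t * c n)"
          using S(3)[OF x] take_enc[OF x, of n] by (simp add: enc_def)
        thus ?thesis by (simp only: of_nat_eq_iff)
      qed
      ultimately show ?thesis
        unfolding dominated_seqs_iff by (simp add: enc_def)
    qed
    moreover have "\<exists>x\<in>S. enc x = ys" if ys: "ys \<in> dominated_seqs t U 0" for ys
    proof -
      define x :: "real ^ 'n" where
        "x = (\<chi> i. if i \<in> ground M then real (ys ! (THE j. j < n \<and> \<sigma> j = i)) else 0)"
      have x\<sigma>: "x $ \<sigma> j = real (ys ! j)" if "j < n" for j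
      proof -
        have "(THE l. l < n \<and> \<sigma> l = \<sigma> j) = j" using that inj by blast
        thus ?thesis using that \<sigma>G by (simp add: x_def)
      qed
      have x0: "x $ i = 0" if "i \<notin> ground M" for i
        using that by (simp add: x_def)
      have len: "length ys = n" using ys by (simp add: dominated_seqs_iff)
      have ys_le: "ys ! j \<le> t" if "j < n" for j
      proof -
        have "ys ! j \<in> set ys" using that len by simp
        thus ?thesis using ys by (auto simp: dominated_seqs_iff)
      qed
      define z where "z m = sum_list (take m ys)" for m
      have z: "z m \<le> t * c m" if "m \<le> n" for m
        using ys that by (simp add: dominated_seqs_iff z_def)
      have zn: "z n = t * c n"
        using ys len by (simp add: dominated_seqs_iff z_def)
      have zSuc: "z (Suc j) = z j + ys ! j" if "j < n" for j
        using that len by (simp add: z_def take_Suc_conv_app_nth)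
      have z0: "z 0 = 0" by (simp add: z_def)
      have "x \<in> (\<lambda>x. real t *\<^sub>R x) ` base_polytope M"
      proof (cases "t = 0")
        case True
        hence "x $ i = 0" for i
          using x0 x\<sigma> G\<sigma> ys_le by (cases "i \<in> ground M") force+
        hence "x = 0" by (simp add: vec_eq_iff)
        moreover have "base_polytope M \<noteq> {}" using ne by (simp add: base_polytope_def)
        ultimately show ?thesis using True by auto
      next
        case False
        \<comment> \<open>\<open>A i\<close> consists of the elements at which \<open>(z m + i) div t\<close> increases.\<close>
        define A where "A i = {\<sigma> j | j. j < n \<and> (z (Suc j) + i) div t \<noteq> (z j + i) div t}" for i
        have mem: "\<sigma> j \<in> A i \<longleftrightarrow> (z (Suc j) + i) div t \<noteq> (z j + i) div t" if "j < n" for i j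
          using that inj by (auto simp: A_def)
        have step: "(z (Suc j) + i) div t = (z j + i) div t + (if \<sigma> j \<in> A i then 1 else 0)"
          if "j < n" for i j
        proof -
          have "(z j + i) div t \<le> (z (Suc j) + i) div t"
            by (intro div_le_mono) (simp add: zSuc that)
          moreover have "(z (Suc j) + i) div t \<le> (z j + i + t) div t"
            by (intro div_le_mono) (simp add: zSuc that ys_le)
          moreover have "(z j + i + t) div t = (z j + i) div t + 1" using False by simp
          ultimately show ?thesis using mem[OF that] by auto
        qed
        have card: "card {j. j < m \<and> \<sigma> j \<in> A i} = (z m + i) div t" if "m \<le> n" "i < t" for m i
          using that(1)
        proof (induction m)
          case 0
          show ?case using that by (simp add: z0)
        next
          case (Suc m)
          have "{j. j < Suc m \<and> \<sigma> j \<in> A i} =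
            (if \<sigma> m \<in> A i then insert m {j. j < m \<and> \<sigma> j \<in> A i} else {j. j < m \<and> \<sigma> j \<in> A i})"
            by (auto simp: less_Suc_eq)
          thus ?case using Suc step[of m i] by simp
        qed
        have "A i \<in> bases M" if "i < t" for i
        proof -
          have "(z m + i) div t \<le> c m" if "m \<le> n" for m
          proof -
            have "z m + i < (c m + 1) * t" using z[OF that] \<open>i < t\<close> by (simp add: mult.commute)
            from less_mult_imp_div_less[OF this] show ?thesis by simp
          qed
          moreover have "(z n + i) div t = c n" using zn \<open>i < t\<close> by simp
          moreover have "A i \<subseteq> ground M" using \<sigma>G by (auto simp: A_def)
          ultimately show ?thesis
            using card[OF _ that] by (simp add: basis_iff)
        qed
        hence "(\<Sum>i<t. (1 / real t) *\<^sub>R indicator_vec (A i)) \<in> base_polytope M"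
          unfolding base_polytope_def using False
          by (intro convex_sum) (auto intro!: hull_inc)
        moreover have "x = real t *\<^sub>R (\<Sum>i<t. (1 / real t) *\<^sub>R indicator_vec (A i))"
        proof -
          have "x $ l = (\<Sum>i<t. indicator_vec (A i) $ l)" for l
          proof (cases "l \<in> ground M")
            case True
            then obtain j where j: "j < n" "l = \<sigma> j" using G\<sigma> by blast
            have "(\<Sum>i<t. indicator_vec (A i) $ l) =
                (\<Sum>i<t. real ((z (Suc j) + i) div t) - real ((z j + i) div t))"
              using step[OF j(1)] by (intro sum.cong) (auto simp: indicator_vec_def j(2))
            also have "\<dots> = real (\<Sum>i<t. (z (Suc j) + i) div t) - real (\<Sum>i<t. (z j + i) div t)"
              by (simp add: sum_subtractf)
            also have "\<dots> = x $ l"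
              using False zSuc[OF j(1)] x\<sigma>[OF j(1)] by (subst (1 2) sum_add_div) (simp_all add: j(2))
            finally show ?thesis by simp
          next
            case False
            hence "l \<notin> A i" for i using \<sigma>G by (auto simp: A_def)
            thus ?thesis using x0[OF False] by (simp add: indicator_vec_def)
          qed
          thus ?thesis
            using False by (simp add: vec_eq_iff scaleR_sum_right[symmetric])
        qed
        ultimately show ?thesis by blast
      qed
      moreover have "x \<in> lattice_points"
        by (simp add: lattice_points_def x_def)
      ultimately have "x \<in> S" by (simp add: S_def)
      moreover have "enc x = ys"
        by (rule nth_equalityI) (simp_all add: enc_def len x\<sigma>)
      ultimately show ?thesis by blast
    qed
    ultimately show "enc ` S = dominated_seqs t U 0" by blast
  qed
  thus ?thesis unfolding S_def by (rule bij_betw_same_card)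
qed

theorem mainTheorem2:
  fixes M :: "'n::finite set_system"
  assumes "schubert_matroid M"
  shows "\<forall>i. coeff (ehr (base_polytope M)) i \<ge> 0"
proof -
  have ne: "bases M \<noteq> {}"
    using assms by (simp add: schubert_matroid_def is_matroid_def)
  obtain U \<sigma> where \<sigma>: "bij_betw \<sigma> {..<length U} (ground M)"
    "bases M = {A. A \<subseteq> ground M \<and>
       (\<forall>m\<le>length U. card {j. j < m \<and> \<sigma> j \<in> A} \<le> count_list (take m U) North) \<and>
       card {j. j < length U \<and> \<sigma> j \<in> A} = count_list U North}"
    by (rule schubert_matroid_bases[OF assms])
  obtain p where p: "nonneg_poly p" "\<And>t. slack_count t U 0 = poly p (real t)"
    using slack_count_positive[of U] by blast
  have "is_ehrhart_poly (base_polytope M) p"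
    unfolding is_ehrhart_poly_def card_lattice_points_base_polytope[OF \<sigma> ne]
    using card_dominated_seqs p(2) by simp
  hence "ehr (base_polytope M) = p" by (rule ehr_eqI)
  thus ?thesis using p(1) by (simp add: nonneg_poly_def)
qed

end
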